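(* Let $X$ be a random variable with a symmetric (about zero) subgaussian distribution, and let $f(z)=\mathbb{E}\,e^{izX}$, $z\in\mathbb{C}$. Suppose that $f$ has exactly one zero $z=x+iy$ in the positive quadrant $x,y\ge 0$. Then $X$ is strictly subgaussian if and only if $|\mathrm{Arg}(z)|\le\frac{\pi}{8}$.
   Context: A random variable $X$ is called subgaussian if $\mathbb{E}\,e^{cX^2}<\infty$ for some constant $c>0$; then its characteristic function extends from the real line to an entire function $f(z)=\mathbb{E}\,e^{izX}$ on $\mathbb{C}$. $X$ is called strictly subgaussian if $\mathbb{E}\,e^{tX}\le e^{\sigma^2t^2/2}$ for all $t\in\mathbb{R}$ with $\sigma^2=\mathrm{Var}(X)$. $\mathrm{Arg}$ is the principal argument, with values in $(-\pi,\pi]$. *)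

theory Defs
  imports "HOL-Probability.Probability"
begin

definition subgaussian :: "'a measure \<Rightarrow> ('a \<Rightarrow> real) \<Rightarrow> bool" where
  "subgaussian M X \<longleftrightarrow> (\<exists>c>0. integrable M (\<lambda>\<omega>. exp (c * (X \<omega>)\<^sup>2)))"

text \<open>
  The Bochner integral of a non-integrable function is 0, so the finiteness of
  \<open>E e^(tX)\<close>, which the inequality expresses on paper, is a separate conjunct.
  It makes the moments in the variance finite as well.
\<close>

definition strictly_subgaussian :: "'a measure \<Rightarrow> ('a \<Rightarrow> real) \<Rightarrow> bool" where
  "strictly_subgaussian M X \<longleftrightarrow>
     (\<forall>t::real. integrable M (\<lambda>\<omega>. exp (t * X \<omega>)) \<and>
        prob_space.expectation M (\<lambda>\<omega>. exp (t * X \<omega>))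
          \<le> exp (prob_space.variance M X * t\<^sup>2 / 2))"

definition symmetric_distribution :: "'a measure \<Rightarrow> ('a \<Rightarrow> real) \<Rightarrow> bool" where
  "symmetric_distribution M X \<longleftrightarrow> distr M borel X = distr M borel (\<lambda>\<omega>. - X \<omega>)"

text \<open>
  The library's \<open>char\<close> takes only real arguments; this is \<open>E e^(izX)\<close> at complex \<open>z\<close>.
  For a subgaussian random variable the integral exists for every \<open>z\<close>.
\<close>

definition complex_char :: "'a measure \<Rightarrow> ('a \<Rightarrow> real) \<Rightarrow> complex \<Rightarrow> complex" where
  "complex_char M X z = (LINT \<omega>|M. exp (\<i> * z * complex_of_real (X \<omega>)))"

end

theory Submission
  imports Defs "HOL-Complex_Analysis.Complex_Analysis"
begin

text \<open>
  Since \<open>X\<close> is symmetric, \<open>f w = E (cos (w X))\<close> depends on \<open>w\<close> only through \<open>w\<^sup>2\<close>: it is \<open>K (w\<^sup>2)\<close> for the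
  entire function \<open>K s = (\<Sum>n. (-1)\<^sup>n E (X\<^sup>2\<^sup>n) / (2n)! s\<^sup>n)\<close>. Subgaussianity bounds \<open>K\<close> by
  \<open>C e\<^bsup>A|s|\<^esup>\<close>. If \<open>z\<close> is the only zero of \<open>f\<close> in the closed quadrant, reflections in the two axes show
  that the zeros of \<open>K\<close> are exactly \<open>\<zeta> = z\<^sup>2\<close> and its conjugate.

  An entire function of exponential type with finitely many zeros is a polynomial times the exponential
  of a linear function. This is the simplest case of Hadamard's factorisation: after the zeros have been
  divided out a holomorphic logarithm \<open>h\<close> exists, its real part grows at most linearly, and the
  Borel--Caratheodory inequality transfers the bound to \<open>h\<close> itself. For real \<open>s\<close> both zeros of \<open>K\<close> are
  equally far from \<open>s\<close>, so that with \<open>u = 1 / \<zeta>\<close>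
  \<open>|K s| = e\<^bsup>\<gamma> s\<^esup> |1 - s u|\<^sup>N\<close>
  for a real \<open>\<gamma>\<close> and the total multiplicity \<open>N > 0\<close>; on the real line only the sum of the two
  multiplicities is visible.

  Now \<open>E e\<^bsup>tX\<^esup> = f (-it) = K (-t\<^sup>2)\<close> and \<open>K' 0 = - Var X / 2\<close>, so that \<open>Var X = 2 N Re u - 2 \<gamma>\<close>. The
  Gaussian factor therefore cancels from the squared strict subgaussian inequality, and so does the
  exponent \<open>N\<close>. What remains, with \<open>s = t\<^sup>2\<close>, is
  \<open>1 + 2 Re u s + |u|\<^sup>2 s\<^sup>2 \<le> e\<^bsup>2 Re u s\<^esup>\<close> for all \<open>s \<ge> 0\<close>.
  Comparison with the second-order Taylor polynomial of the exponential shows that this means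
  \<open>Re u \<ge> 0\<close> and \<open>|u|\<^sup>2 \<le> 2 (Re u)\<^sup>2\<close>. Thus \<open>\<bar>Arg u\<bar> \<le> \<pi>/4\<close>, the same holds for \<open>z\<^sup>2 = 1 / u\<close>, and for
  \<open>z\<close> in the quadrant this is \<open>\<bar>Arg z\<bar> \<le> \<pi>/8\<close>.
\<close>

section \<open>Entire functions of exponential type with finitely many zeros\<close>

text \<open>
  The Moebius map \<open>v \<mapsto> v / (2 B - v)\<close> takes the half-plane \<open>Re v < B\<close> into the unit disc and fixes 0,
  so the Schwarz lemma applies to its composition with \<open>h\<close> and bounds that composition by 1/2 on the
  half-ball. Solving for \<open>h\<close> gives the claim.
\<close>
lemma Borel_Caratheodory_half_ball:
  assumes holh: "h holomorphic_on ball 0 r" and h0: "h 0 = 0" and "0 < r"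
    and Re_less: "\<And>z. norm z < r \<Longrightarrow> Re (h z) < B"
    and z: "norm z \<le> r / 2"
  shows "norm (h z) \<le> 2 * B"
proof -
  have "0 < B"
    using Re_less[of 0] \<open>0 < r\<close> h0 by simp
  define \<phi> where "\<phi> = (\<lambda>w. h (of_real r * w) / (2 * of_real B - h (of_real r * w)))"
  have in_ball: "norm (of_real r * w) < r" if "norm w < 1" for w :: complex
    using that \<open>0 < r\<close> by (simp add: norm_mult)
  have closer: "norm v < norm (2 * of_real B - v)" if "Re v < B" for v :: complex
  proof -
    have "(norm v)\<^sup>2 < (norm (2 * of_real B - v))\<^sup>2"
      using mult_strict_left_mono[OF that \<open>0 < B\<close>]
      unfolding cmod_power2 by (simp add: power2_eq_square algebra_simps)
    then show ?thesis
      by (rule power_less_imp_less_base) simp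
  qed
  have nz: "2 * of_real B - h (of_real r * w) \<noteq> 0" if "norm w < 1" for w
    using closer[OF Re_less[OF in_ball[OF that]]] by auto
  have "(\<lambda>w. h (of_real r * w)) holomorphic_on ball 0 1"
    by (rule holomorphic_on_compose_gen[OF _ holh, unfolded o_def])
       (auto intro!: holomorphic_intros simp: in_ball)
  then have "\<phi> holomorphic_on ball 0 1"
    unfolding \<phi>_def using nz by (intro holomorphic_intros) auto
  moreover have "\<phi> 0 = 0"
    by (simp add: \<phi>_def h0)
  moreover have "norm (\<phi> w) < 1" if "norm w < 1" for w
    using closer[OF Re_less[OF in_ball[OF that]]] nz[OF that]
    by (simp add: \<phi>_def norm_divide)
  moreover have w1: "norm (z / of_real r) < 1"
    using z \<open>0 < r\<close> by (simp add: norm_divide field_simps)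
  ultimately have "norm (\<phi> (z / of_real r)) \<le> norm (z / of_real r)"
    by (rule Schwarz_Lemma(1))
  also have "\<dots> \<le> 1 / 2"
    using z \<open>0 < r\<close> by (simp add: norm_divide field_simps)
  finally have "norm (h z) / norm (2 * of_real B - h z) \<le> 1 / 2"
    using \<open>0 < r\<close> by (simp add: \<phi>_def norm_divide)
  then have "2 * norm (h z) \<le> norm (2 * of_real B - h z)"
    using nz[OF w1] \<open>0 < r\<close> by (simp add: field_simps split: if_splits)
  also have "\<dots> \<le> 2 * B + norm (h z)"
    using norm_triangle_ineq4[of "2 * of_real B" "h z"] \<open>0 < B\<close> by (simp add: norm_mult)
  finally show ?thesis by simp
qed

definition exponential_type :: "(complex \<Rightarrow> complex) \<Rightarrow> bool" where
  "exponential_type f \<longleftrightarrow> (\<exists>C A. \<forall>z. norm (f z) \<le> C * exp (A * norm z))"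

text \<open>
  A holomorphic logarithm \<open>h\<close> of \<open>g\<close> has a real part of at most linear growth. The Borel--Caratheodory
  inequality on the ball of radius \<open>2 |z|\<close> makes \<open>h\<close> itself grow at most linearly, and Liouville's
  theorem for polynomial growth applies.
\<close>
lemma zero_free_exponential_type:
  assumes holg: "g holomorphic_on UNIV" and nz: "\<And>z. g z \<noteq> 0" and "exponential_type g"
  shows "\<exists>\<alpha> \<beta>. \<forall>z. g z = exp (\<alpha> * z + \<beta>)"
proof -
  obtain C A where bound: "norm (g z) \<le> C * exp (A * norm z)" for z
    using \<open>exponential_type g\<close> unfolding exponential_type_def by blast
  obtain h where holh: "h holomorphic_on UNIV" and h: "\<And>z. g z = exp (h z)"
    using contractible_imp_holomorphic_log[OF holg] nz convex_imp_contractible[OF convex_UNIV]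
    by (metis UNIV_I)
  \<comment> \<open>The absolute values keep both constants nonnegative, so the bound grows with the radius; the 1 makes it strict.\<close>
  define B where "B = \<bar>ln C - Re (h 0)\<bar> + 1"
  define A' where "A' = \<bar>A\<bar>"
  have "0 < B" "0 \<le> A'"
    by (simp_all add: B_def A'_def)
  have "0 < norm (g 0)"
    using nz by simp
  also have "norm (g 0) \<le> C"
    using bound[of 0] by simp
  finally have "0 < C" .
  have Re_le: "Re (h z - h 0) < B + A' * norm z" for z
  proof -
    have "exp (Re (h z)) \<le> C * exp (A * norm z)"
      using bound[of z] by (simp add: h)
    also have "\<dots> = exp (ln C + A * norm z)"
      using \<open>0 < C\<close> by (simp add: exp_add)
    finally have "Re (h z) \<le> ln C + A * norm z"
      by simp
    also have "A * norm z \<le> A' * norm z"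
      by (simp add: A'_def mult_right_mono)
    finally show ?thesis
      by (simp add: B_def)
  qed
  have linear: "norm (h z - h 0) \<le> 2 * (B + 2 * A') * norm z ^ 1" if "1 \<le> norm z" for z
  proof -
    have "norm (h z - h 0) \<le> 2 * (B + A' * (2 * norm z))"
    proof (rule Borel_Caratheodory_half_ball[where r = "2 * norm z" and h = "\<lambda>z. h z - h 0"])
      fix w :: complex assume "norm w < 2 * norm z"
      then have "A' * norm w \<le> A' * (2 * norm z)"
        using \<open>0 \<le> A'\<close> by (intro mult_left_mono) auto
      then show "Re (h w - h 0) < B + A' * (2 * norm z)"
        using Re_le[of w] by simp
    qed (use that in \<open>auto intro!: holomorphic_intros holomorphic_on_subset[OF holh]\<close>)
    moreover have "B \<le> B * norm z"
      using that \<open>0 < B\<close> by simp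
    ultimately show ?thesis
      by (simp add: algebra_simps)
  qed
  define D where "D = deriv (\<lambda>z. h z - h 0) 0"
  have "h z = D * z + h 0" for z
  proof -
    have "(\<lambda>z. h z - h 0) holomorphic_on UNIV"
      by (intro holomorphic_intros holh)
    from Liouville_polynomial[OF this linear, where \<xi> = z]
    have "h z - h 0 = D * z"
      by (simp add: D_def)
    then show ?thesis
      by (simp only: diff_eq_eq)
  qed
  then have "\<forall>z. g z = exp (D * z + h 0)"
    unfolding h by (intro allI arg_cong[where f = exp])
  then show ?thesis
    by blast
qed

text \<open>
  The quotient of \<open>f\<close> by the full power of \<open>z - a\<close> is extended over \<open>a\<close> by the local factor that the
  order of the zero provides; \<open>n = 0\<close> covers the case that \<open>a\<close> is not a zero.
\<close>
lemma entire_divide_zero: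
  assumes holf: "f holomorphic_on UNIV" and nz: "f b \<noteq> 0"
  obtains g n where "g holomorphic_on UNIV" "g a \<noteq> 0" "\<And>z. f z = (z - a) ^ n * g z"
proof -
  obtain r where "r > 0" and hol: "zor_poly f a holomorphic_on cball a r"
    and fact: "\<And>w. w \<in> cball a r \<Longrightarrow>
      f w = zor_poly f a w * (w - a) ^ nat (zorder f a) \<and> zor_poly f a w \<noteq> 0"
    using zorder_exist_zero[OF holf open_UNIV connected_UNIV UNIV_I[of a]] nz by blast
  define n where "n = nat (zorder f a)"
  define g where "g = (\<lambda>w. if w = a then zor_poly f a a else f w / (w - a) ^ n)"
  have g_ball: "g w = zor_poly f a w" if "w \<in> ball a r" for w
    using fact[of w] that by (auto simp: g_def n_def)
  have "g holomorphic_on (ball a r \<union> - {a})"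
  proof (rule holomorphic_on_Un)
    have "zor_poly f a holomorphic_on ball a r"
      using hol by (rule holomorphic_on_subset) auto
    then show "g holomorphic_on ball a r"
      by (rule holomorphic_transform) (simp add: g_ball)
    have "(\<lambda>w. f w / (w - a) ^ n) holomorphic_on - {a}"
      by (intro holomorphic_intros holomorphic_on_subset[OF holf]) auto
    then show "g holomorphic_on - {a}"
      by (rule holomorphic_transform) (simp add: g_def)
  qed auto
  moreover have "ball a r \<union> - {a} = UNIV"
    using \<open>r > 0\<close> by auto
  ultimately have "g holomorphic_on UNIV"
    by simp
  moreover have "g a \<noteq> 0"
    using fact[of a] \<open>r > 0\<close> by (simp add: g_def)
  moreover have "f z = (z - a) ^ n * g z" for z
    using fact[of a] \<open>r > 0\<close> by (auto simp: g_def n_def)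
  ultimately show thesis
    by (rule that)
qed

text \<open>
  Outside the unit disc about \<open>a\<close> the divisor has modulus at least 1, so the bound for \<open>f\<close> carries over
  to \<open>g\<close>; on the closed disc \<open>g\<close> is bounded by compactness.
\<close>
lemma exponential_type_divide:
  assumes "exponential_type f" and holg: "g holomorphic_on UNIV"
    and fg: "\<And>z. f z = (z - a) ^ n * g z"
  shows "exponential_type g"
proof -
  obtain C A where bound: "norm (f z) \<le> C * exp (A * norm z)" for z
    using \<open>exponential_type f\<close> unfolding exponential_type_def by blast
  have "continuous_on (cball a 1) g"
    using holg by (meson holomorphic_on_imp_continuous_on holomorphic_on_subset subset_UNIV)
  then have "bounded (g ` cball a 1)"
    by (intro compact_imp_bounded compact_continuous_image) auto
  then obtain D where D: "norm (g z) \<le> D" if "z \<in> cball a 1" for z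
    by (metis bounded_iff imageI)
  have "norm (g z) \<le> (\<bar>C\<bar> + \<bar>D\<bar>) * exp (\<bar>A\<bar> * norm z)" for z
  proof (cases "z \<in> cball a 1")
    case True
    have "norm (g z) \<le> (\<bar>C\<bar> + \<bar>D\<bar>) * 1"
      using D[OF True] by simp
    also have "\<dots> \<le> (\<bar>C\<bar> + \<bar>D\<bar>) * exp (\<bar>A\<bar> * norm z)"
      by (intro mult_left_mono) auto
    finally show ?thesis .
  next
    case False
    then have "1 \<le> norm (z - a) ^ n"
      by (simp add: dist_norm norm_minus_commute)
    then have "norm (g z) \<le> norm (z - a) ^ n * norm (g z)"
      by (simp add: mult_le_cancel_right1)
    also have "\<dots> = norm (f z)"
      by (simp add: fg norm_mult norm_power)
    also have "\<dots> \<le> C * exp (A * norm z)"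
      by (rule bound)
    also have "\<dots> \<le> (\<bar>C\<bar> + \<bar>D\<bar>) * exp (\<bar>A\<bar> * norm z)"
      by (intro mult_mono) (auto intro: mult_right_mono)
    finally show ?thesis .
  qed
  then show ?thesis
    unfolding exponential_type_def by blast
qed

text \<open>
  Dividing out one zero at a time, with its multiplicity, keeps the function entire and of exponential
  type, until a zero-free function is left.
\<close>
lemma finitely_many_zeros_exponential_type:
  assumes "finite Z" and "f holomorphic_on UNIV" and "exponential_type f"
    and "f b \<noteq> 0" and "\<And>z. f z = 0 \<Longrightarrow> z \<in> Z"
  shows "\<exists>\<alpha> \<beta> n. \<forall>z. f z = exp (\<alpha> * z + \<beta>) * (\<Prod>a\<in>Z. (z - a) ^ n a)"
  using assms
proof (induction Z arbitrary: f b rule: finite_induct)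
  case empty
  then show ?case
    using zero_free_exponential_type[of f] by auto
next
  case (insert a Z)
  obtain g k where g: "g holomorphic_on UNIV" "g a \<noteq> 0" "\<And>z. f z = (z - a) ^ k * g z"
    by (rule entire_divide_zero[OF insert.prems(1,3), of a]) blast
  have "exponential_type g"
    by (rule exponential_type_divide[OF insert.prems(2) g(1,3)])
  moreover have "z \<in> Z" if "g z = 0" for z
    using insert.prems(4)[of z] g(2,3) that by auto
  ultimately obtain \<alpha> \<beta> n where n: "\<And>z. g z = exp (\<alpha> * z + \<beta>) * (\<Prod>a\<in>Z. (z - a) ^ n a)"
    using insert.IH[OF g(1) _ g(2)] by blast
  have "f z = exp (\<alpha> * z + \<beta>) * (\<Prod>b\<in>insert a Z. (z - b) ^ (n(a := k)) b)" for z
  proof -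
    have "(\<Prod>b\<in>Z. (z - b) ^ (n(a := k)) b) = (\<Prod>b\<in>Z. (z - b) ^ n b)"
      using \<open>a \<notin> Z\<close> by (intro prod.cong) auto
    then show ?thesis
      using insert.hyps by (simp add: g(3) n)
  qed
  then show ?case
    by blast
qed

text \<open>
  A real point has the same distance to \<open>\<zeta>\<close> and to its conjugate. The exponent \<open>N\<close> is therefore the sum
  of the two multiplicities, and the formula covers a real \<open>\<zeta>\<close>, where the two zeros coincide, as well.
  The normalisation \<open>f 0 = 1\<close> absorbs the constant factor.
\<close>
lemma norm_on_reals_conjugate_zero_pair:
  assumes "f holomorphic_on UNIV" and "exponential_type f" and f0: "f 0 = 1"
    and zeros: "\<And>s. f s = 0 \<longleftrightarrow> s = \<zeta> \<or> s = cnj \<zeta>"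
  obtains \<gamma> :: real and N :: nat
    where "0 < N" "\<And>s::real. norm (f (of_real s)) = exp (\<gamma> * s) * norm (1 - of_real s / \<zeta>) ^ N"
proof -
  have "\<zeta> \<noteq> 0"
    using zeros[of 0] f0 by auto
  obtain \<alpha> \<beta> n where f: "\<And>z. f z = exp (\<alpha> * z + \<beta>) * (\<Prod>a\<in>{\<zeta>, cnj \<zeta>}. (z - a) ^ n a)"
    using finitely_many_zeros_exponential_type[of "{\<zeta>, cnj \<zeta>}" f 0] assms by auto
  \<comment> \<open>The sum runs over a set, so a real zero is counted only once.\<close>
  define N where "N = (\<Sum>a\<in>{\<zeta>, cnj \<zeta>}. n a)"
  have dist_eq: "norm (of_real s - cnj \<zeta>) = norm (of_real s - \<zeta>)" for s :: real
    by (metis complex_cnj_complex_of_real complex_cnj_diff complex_mod_cnj)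
  have norm_f: "norm (f (of_real s)) = exp (Re \<alpha> * s + Re \<beta>) * norm (of_real s - \<zeta>) ^ N" for s :: real
  proof -
    have "(\<Prod>a\<in>{\<zeta>, cnj \<zeta>}. norm (of_real s - a) ^ n a)
        = (\<Prod>a\<in>{\<zeta>, cnj \<zeta>}. norm (of_real s - \<zeta>) ^ n a)"
      by (intro prod.cong) (auto simp: dist_eq)
    also have "\<dots> = norm (of_real s - \<zeta>) ^ N"
      by (simp add: N_def power_sum)
    finally show ?thesis
      by (simp add: f norm_mult prod_norm[symmetric] norm_power)
  qed
  have normalise: "exp (Re \<beta>) * norm \<zeta> ^ N = 1"
    using norm_f[of 0] f0 by simp
  have "norm (f (of_real s)) = exp (Re \<alpha> * s) * norm (1 - of_real s / \<zeta>) ^ N" for s :: real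
  proof -
    have "norm (of_real s - \<zeta>) = norm \<zeta> * norm (1 - of_real s / \<zeta>)"
      using \<open>\<zeta> \<noteq> 0\<close>
      by (simp add: norm_mult[symmetric] right_diff_distrib norm_minus_commute)
    then show ?thesis
      using normalise by (simp add: norm_f power_mult_distrib exp_add)
  qed
  moreover have "0 < N"
  proof (rule ccontr)
    assume "\<not> 0 < N"
    then have "f \<zeta> \<noteq> 0"
      by (auto simp: N_def f)
    then show False
      using zeros by blast
  qed
  ultimately show thesis
    by (intro that)
qed

section \<open>The characteristic function of a symmetric subgaussian variable\<close>

lemma cos_even_sums: "(\<lambda>n. (-1) ^ n / fact (2 * n) * (x\<^sup>2) ^ n) sums cos x"
  for x :: "'a::{real_normed_field,banach}"
proof -
  have "(\<lambda>n. cos_coeff (2 * n) *\<^sub>R x ^ (2 * n)) sums cos x"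
    using cos_converges[of x]
    by (subst sums_mono_reindex[of "\<lambda>n. 2 * n" "\<lambda>n. cos_coeff n *\<^sub>R x ^ n"])
       (auto simp: strict_mono_def cos_coeff_def elim!: evenE)
  then show ?thesis
    by (simp add: cos_coeff_def scaleR_conv_of_real power_mult)
qed

lemma cosh_even_sums: "(\<lambda>n. x ^ (2 * n) / fact (2 * n)) sums cosh x" for x :: real
proof -
  have "(\<lambda>n. (\<lambda>n. if even n then x ^ n /\<^sub>R fact n else 0) (2 * n)) sums cosh x"
    using cosh_converges[of x]
    by (subst sums_mono_reindex[of "\<lambda>n. 2 * n" "\<lambda>n. if even n then x ^ n /\<^sub>R fact n else 0"])
       (auto simp: strict_mono_def elim!: evenE)
  then show ?thesis
    by (simp add: divide_inverse mult.commute)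
qed

text \<open>
  Completing the square: \<open>y x \<le> y\<^sup>2 / (4 c) + c x\<^sup>2\<close>. This is how a finite expectation of \<open>e\<^bsup>c X\<^sup>2\<^esup>\<close> controls all
  exponential moments.
\<close>
lemma exp_mult_le_exp_square:
  fixes c x y :: real
  assumes "0 < c"
  shows "exp (y * x) \<le> exp (y\<^sup>2 / (4 * c)) * exp (c * x\<^sup>2)"
proof -
  have "0 \<le> (y - 2 * c * x)\<^sup>2 / (4 * c)"
    using assms by simp
  also have "\<dots> = y\<^sup>2 / (4 * c) + c * x\<^sup>2 - y * x"
    using assms by (simp add: power2_eq_square field_simps)
  finally show ?thesis
    by (simp add: exp_add[symmetric])
qed

locale symmetric_subgaussian = prob_space M for M :: "'a measure" +
  fixes X :: "'a \<Rightarrow> real"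
  assumes X_measurable [measurable]: "X \<in> borel_measurable M"
    and symmetric: "symmetric_distribution M X"
    and subgaussian: "subgaussian M X"
begin

lemma integral_reflect:
  fixes \<phi> :: "real \<Rightarrow> 'b::{banach, second_countable_topology}"
  assumes [measurable]: "\<phi> \<in> borel_measurable borel"
  shows "(LINT \<omega>|M. \<phi> (- X \<omega>)) = (LINT \<omega>|M. \<phi> (X \<omega>))"
proof -
  have "(LINT \<omega>|M. \<phi> (- X \<omega>)) = (LINT x|distr M borel (\<lambda>\<omega>. - X \<omega>). \<phi> x)"
    by (subst integral_distr) simp_all
  also have "\<dots> = (LINT x|distr M borel X. \<phi> x)"
    using symmetric by (simp add: symmetric_distribution_def)
  also have "\<dots> = (LINT \<omega>|M. \<phi> (X \<omega>))"
    by (subst integral_distr) simp_all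
  finally show ?thesis .
qed

text \<open>
  A symmetric variable has mean zero.
\<close>
lemma variance_eq_second_moment: "variance X = expectation (\<lambda>\<omega>. (X \<omega>)\<^sup>2)"
proof -
  have "expectation X = 0"
    using integral_reflect[of "\<lambda>x. x"] by simp
  then show ?thesis
    by simp
qed

lemma exp_integrable: "integrable M (\<lambda>\<omega>. exp (y * X \<omega>))"
  and exp_abs_integrable: "integrable M (\<lambda>\<omega>. exp (y * \<bar>X \<omega>\<bar>))"
  and exp_abs_expectation_bound: "\<exists>C a. \<forall>y. expectation (\<lambda>\<omega>. exp (y * \<bar>X \<omega>\<bar>)) \<le> C * exp (a * y\<^sup>2)"
proof -
  obtain c where "0 < c" and c: "integrable M (\<lambda>\<omega>. exp (c * (X \<omega>)\<^sup>2))"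
    using subgaussian by (auto simp: subgaussian_def)
  have bound: "exp (y * x) \<le> exp (y\<^sup>2 / (4 * c)) * exp (c * x\<^sup>2)" for x y
    by (rule exp_mult_le_exp_square[OF \<open>0 < c\<close>])
  have bound_abs: "exp (y * \<bar>x\<bar>) \<le> exp (y\<^sup>2 / (4 * c)) * exp (c * x\<^sup>2)" for x y
    using bound[of y "\<bar>x\<bar>"] by simp
  have int: "integrable M (\<lambda>\<omega>. exp (y\<^sup>2 / (4 * c)) * exp (c * (X \<omega>)\<^sup>2))" for y
    using c by simp
  show "integrable M (\<lambda>\<omega>. exp (y * X \<omega>))" for y
    by (rule Bochner_Integration.integrable_bound[OF int[of y]]) (auto simp: bound)
  show int_abs: "integrable M (\<lambda>\<omega>. exp (y * \<bar>X \<omega>\<bar>))" for y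
    by (rule Bochner_Integration.integrable_bound[OF int[of y]]) (auto simp: bound_abs)
  have "expectation (\<lambda>\<omega>. exp (y * \<bar>X \<omega>\<bar>))
      \<le> expectation (\<lambda>\<omega>. exp (c * (X \<omega>)\<^sup>2)) * exp (1 / (4 * c) * y\<^sup>2)" for y
    using integral_mono[OF int_abs[of y] int[of y] bound_abs] by (simp add: mult.commute)
  then show "\<exists>C a. \<forall>y. expectation (\<lambda>\<omega>. exp (y * \<bar>X \<omega>\<bar>)) \<le> C * exp (a * y\<^sup>2)"
    by blast
qed

lemma norm_char_integrand_le: "norm (exp (\<i> * w * of_real x)) \<le> exp (norm w * \<bar>x\<bar>)"
proof -
  have "norm (\<i> * w * of_real x) = norm w * \<bar>x\<bar>"
    by (simp add: norm_mult)
  then show ?thesis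
    by (metis norm_exp)
qed

lemma char_integrand_integrable: "integrable M (\<lambda>\<omega>. exp (\<i> * w * of_real (X \<omega>)))"
  by (rule Bochner_Integration.integrable_bound[OF exp_abs_integrable[of "norm w"]])
     (simp_all add: norm_char_integrand_le del: norm_exp_eq_Re)

lemma norm_complex_char_le: "norm (complex_char M X w) \<le> expectation (\<lambda>\<omega>. exp (norm w * \<bar>X \<omega>\<bar>))"
  unfolding complex_char_def
  by (rule order_trans[OF integral_norm_bound])
     (intro integral_mono integrable_norm char_integrand_integrable exp_abs_integrable
        norm_char_integrand_le)

lemma complex_char_imaginary: "complex_char M X (- \<i> * of_real t) = of_real (expectation (\<lambda>\<omega>. exp (t * X \<omega>)))"
proof -
  have "complex_char M X (- \<i> * of_real t) = (LINT \<omega>|M. complex_of_real (exp (t * X \<omega>)))"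
    unfolding complex_char_def by (simp add: exp_of_real[symmetric] mult.assoc[symmetric])
  then show ?thesis
    by simp
qed

text \<open>
  Symmetry allows \<open>e\<^bsup>iwX\<^esup>\<close> to be averaged with \<open>e\<^bsup>-iwX\<^esup>\<close> under the expectation.
\<close>
lemma complex_char_eq_cos: "complex_char M X w = (LINT \<omega>|M. cos (w * of_real (X \<omega>)))"
proof -
  have reflected: "(LINT \<omega>|M. exp (\<i> * w * of_real (- X \<omega>))) = complex_char M X w"
    unfolding complex_char_def
    by (rule integral_reflect[of "\<lambda>x. exp (\<i> * w * of_real x)"]) measurable
  have int_reflected: "integrable M (\<lambda>\<omega>. exp (\<i> * w * of_real (- X \<omega>)))"
    using char_integrand_integrable[of "- w"] by simp
  have "(LINT \<omega>|M. cos (w * of_real (X \<omega>)))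
      = (LINT \<omega>|M. (exp (\<i> * w * of_real (X \<omega>)) + exp (\<i> * w * of_real (- X \<omega>))) / 2)"
    by (simp add: cos_exp_eq mult.assoc)
  also have "\<dots> = (complex_char M X w + complex_char M X w) / 2"
    unfolding integral_divide_zero
    by (subst Bochner_Integration.integral_add[OF char_integrand_integrable int_reflected])
       (simp only: reflected, simp only: complex_char_def)
  finally show ?thesis
    by simp
qed

text \<open>
  The coefficients of the power series in \<open>w\<^sup>2\<close> that results from integrating the cosine series term by term.
\<close>
definition even_moment_coeff :: "nat \<Rightarrow> real" where
  "even_moment_coeff n = (-1) ^ n / fact (2 * n) * expectation (\<lambda>\<omega>. X \<omega> ^ (2 * n))"

text \<open>
  The absolute values of the terms of the cosine series of \<open>w X\<close> add up to \<open>cosh (|w| |X|)\<close>, which is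
  at most the integrable function \<open>e\<^bsup>|w| |X|\<^esup>\<close>. This permits termwise integration.
\<close>
lemma even_moment_series: "(\<lambda>n. of_real (even_moment_coeff n) * (w\<^sup>2) ^ n) sums complex_char M X w"
proof -
  define f where "f = (\<lambda>n \<omega>. (-1) ^ n / fact (2 * n) * (w * of_real (X \<omega>))\<^sup>2 ^ n)"
  have [measurable]: "f n \<in> borel_measurable M" for n
    unfolding f_def by measurable
  have norm_f: "norm (f n \<omega>) = (norm w * \<bar>X \<omega>\<bar>) ^ (2 * n) / fact (2 * n)" for n \<omega>
    by (simp add: f_def norm_mult norm_divide norm_power power_mult power_mult_distrib)
  have norm_sums: "(\<lambda>n. norm (f n \<omega>)) sums cosh (norm w * \<bar>X \<omega>\<bar>)" for \<omega>
    unfolding norm_f by (rule cosh_even_sums)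
  have cosh_le: "cosh y \<le> exp y" if "0 \<le> y" for y :: real
    using that by (simp add: cosh_def)
  have partial_le: "(\<Sum>n\<in>I. norm (f n \<omega>)) \<le> exp (norm w * \<bar>X \<omega>\<bar>)" if "finite I" for I \<omega>
  proof -
    have "(\<Sum>n\<in>I. norm (f n \<omega>)) \<le> cosh (norm w * \<bar>X \<omega>\<bar>)"
      using norm_sums[of \<omega>] sum_le_suminf[of "\<lambda>n. norm (f n \<omega>)" I] that
      by (simp add: sums_iff)
    also have "\<dots> \<le> exp (norm w * \<bar>X \<omega>\<bar>)"
      by (rule cosh_le) simp
    finally show ?thesis .
  qed
  have int_f: "integrable M (f n)" for n
    by (rule Bochner_Integration.integrable_bound[OF exp_abs_integrable[of "norm w"]])
       (use partial_le[of "{n}"] in auto)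
  have "(\<Sum>n<m. LINT \<omega>|M. norm (f n \<omega>)) \<le> expectation (\<lambda>\<omega>. exp (norm w * \<bar>X \<omega>\<bar>))" for m
  proof -
    have "(\<Sum>n<m. LINT \<omega>|M. norm (f n \<omega>)) = (LINT \<omega>|M. (\<Sum>n<m. norm (f n \<omega>)))"
      by (rule Bochner_Integration.integral_sum[symmetric]) (intro integrable_norm int_f)
    also have "\<dots> \<le> expectation (\<lambda>\<omega>. exp (norm w * \<bar>X \<omega>\<bar>))"
      by (intro integral_mono Bochner_Integration.integrable_sum integrable_norm int_f
          exp_abs_integrable partial_le) simp
    finally show ?thesis .
  qed
  then have summable_int: "summable (\<lambda>n. LINT \<omega>|M. norm (f n \<omega>))"
    by (intro summableI_nonneg_bounded) auto
  have "(\<lambda>n. LINT \<omega>|M. f n \<omega>) sums (LINT \<omega>|M. (\<Sum>n. f n \<omega>))"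
    using norm_sums by (intro sums_integral int_f summable_int) (auto simp: sums_iff)
  moreover have "(\<Sum>n. f n \<omega>) = cos (w * of_real (X \<omega>))" for \<omega>
    using cos_even_sums[of "w * of_real (X \<omega>)"] by (simp add: f_def sums_iff)
  moreover have "(LINT \<omega>|M. f n \<omega>) = of_real (even_moment_coeff n) * (w\<^sup>2) ^ n" for n
  proof -
    have "f n = (\<lambda>\<omega>. ((-1) ^ n / fact (2 * n) * (w\<^sup>2) ^ n) * of_real (X \<omega> ^ (2 * n)))"
      by (simp add: f_def fun_eq_iff power_mult_distrib power_mult)
    then have "(LINT \<omega>|M. f n \<omega>)
      = ((-1) ^ n / fact (2 * n) * (w\<^sup>2) ^ n) * of_real (expectation (\<lambda>\<omega>. X \<omega> ^ (2 * n)))"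
      by (simp del: of_real_power)
    then show ?thesis
      by (simp add: even_moment_coeff_def)
  qed
  ultimately show ?thesis
    by (simp add: complex_char_eq_cos)
qed

text \<open>
  The even characteristic function has order at most 2, and passing to the variable \<open>w\<^sup>2\<close> halves the
  order: the Gaussian bound on exponential moments becomes exponential type. The derivative at 0 is the
  first coefficient of the moment series.
\<close>
lemma complex_char_as_function_of_square:
  obtains K where "K holomorphic_on UNIV" "exponential_type K" "\<And>w. K (w\<^sup>2) = complex_char M X w"
    "(K has_field_derivative - of_real (variance X) / 2) (at 0)"
proof
  define K where "K = (\<lambda>s. \<Sum>n. of_real (even_moment_coeff n) * s ^ n :: complex)"
  show K_square: "K (w\<^sup>2) = complex_char M X w" for w
    using even_moment_series[of w] by (simp add: K_def sums_iff)
  have summable: "summable (\<lambda>n. of_real (even_moment_coeff n) * s ^ n)" for s :: complex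
    using even_moment_series[of "csqrt s"] by (simp add: sums_iff)
  have deriv: "(K has_field_derivative (\<Sum>n. diffs (\<lambda>n. of_real (even_moment_coeff n)) n * s ^ n)) (at s)" for s
    unfolding K_def by (rule termdiffs_strong_converges_everywhere[OF summable])
  then show "K holomorphic_on UNIV"
    by (auto simp: holomorphic_on_def field_differentiable_def)
  have "even_moment_coeff 1 = - variance X / 2"
    by (simp add: even_moment_coeff_def variance_eq_second_moment)
  then have "(\<Sum>n. diffs (\<lambda>n. of_real (even_moment_coeff n)) n * 0 ^ n) = - of_real (variance X) / (2::complex)"
    by (simp add: powser_zero diffs_def)
  then show "(K has_field_derivative - of_real (variance X) / 2) (at 0)"
    using deriv[of 0] by simp
  obtain C a where "\<And>y. expectation (\<lambda>\<omega>. exp (y * \<bar>X \<omega>\<bar>)) \<le> C * exp (a * y\<^sup>2)"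
    using exp_abs_expectation_bound by blast
  then have "norm (K s) \<le> C * exp (a * norm s)" for s
    using norm_complex_char_le[of "csqrt s"] K_square[of "csqrt s"]
    by (metis norm_power order_trans power2_csqrt)
  then show "exponential_type K"
    unfolding exponential_type_def by blast
qed

end

section \<open>An exponential inequality and the argument of a complex number\<close>

text \<open>
  Near 0 the exponential is \<open>1 + 2 a s + 2 a\<^sup>2 s\<^sup>2 + o(s\<^sup>2)\<close>, which forces \<open>q \<le> 2 a\<^sup>2\<close>; for negative \<open>a\<close>
  the quadratic returns to the value 1 at a positive \<open>s\<close>, where the exponential has dropped below 1.
  Conversely, for nonnegative \<open>a\<close> the exponential exceeds its second-order Taylor polynomial.
\<close>
lemma quadratic_le_exp_iff:
  fixes a q :: real
  assumes "0 < q"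
  shows "(\<forall>s\<ge>0. 1 + 2 * a * s + q * s\<^sup>2 \<le> exp (2 * a * s)) \<longleftrightarrow> 0 \<le> a \<and> q \<le> 2 * a\<^sup>2"
proof safe
  assume le: "\<forall>s\<ge>0. 1 + 2 * a * s + q * s\<^sup>2 \<le> exp (2 * a * s)"
  show "0 \<le> a"
  proof (rule ccontr)
    assume "\<not> 0 \<le> a"
    \<comment> \<open>The second root of \<open>2 * a * s + q * s\<^sup>2 = 0\<close>.\<close>
    define s where "s = - 2 * a / q"
    have "0 < s"
      using \<open>\<not> 0 \<le> a\<close> \<open>0 < q\<close> by (simp add: s_def divide_neg_pos)
    have "1 = 1 + 2 * a * s + q * s\<^sup>2"
      using \<open>0 < q\<close> by (simp add: s_def power2_eq_square)
    also have "\<dots> \<le> exp (2 * a * s)"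
      using le \<open>0 < s\<close> by simp
    also have "\<dots> < 1"
      using \<open>0 < s\<close> \<open>\<not> 0 \<le> a\<close> by (simp add: mult_neg_pos)
    finally show False by simp
  qed
  have "((\<lambda>s. (exp (2 * a * s) - 1 - 2 * a * s) / s\<^sup>2) \<longlongrightarrow> 2 * a * a) (at_right 0)"
    by real_asymp
  moreover have "\<forall>\<^sub>F s in at_right 0. q \<le> (exp (2 * a * s) - 1 - 2 * a * s) / s\<^sup>2"
    using eventually_at_right_less[of "0::real"]
  proof eventually_elim
    case (elim s)
    with le have "1 + 2 * a * s + q * s\<^sup>2 \<le> exp (2 * a * s)"
      by simp
    then show ?case
      using elim by (simp add: field_simps)
  qed
  ultimately have "q \<le> 2 * a * a"
    by (rule tendsto_lowerbound) simp
  then show "q \<le> 2 * a\<^sup>2"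
    by (simp add: power2_eq_square)
next
  fix s :: real
  assume "0 \<le> a" "q \<le> 2 * a\<^sup>2" "0 \<le> s"
  have "q * s\<^sup>2 \<le> 2 * a\<^sup>2 * s\<^sup>2"
    using \<open>q \<le> 2 * a\<^sup>2\<close> by (simp add: mult_right_mono)
  then have "1 + 2 * a * s + q * s\<^sup>2 \<le> 1 + 2 * a * s + (2 * a * s)\<^sup>2 / 2"
    by (simp add: power_mult_distrib)
  also have "\<dots> \<le> exp (2 * a * s)"
    using \<open>0 \<le> a\<close> \<open>0 \<le> s\<close> by (intro exp_lower_Taylor_quadratic) simp
  finally show "1 + 2 * a * s + q * s\<^sup>2 \<le> exp (2 * a * s)" .
qed

text \<open>
  With \<open>\<theta> = Arg z \<in> [0, \<pi>/2]\<close>, the conditions on \<open>z\<^sup>2\<close> say \<open>cos (2 \<theta>) \<ge> 0\<close> and \<open>cos (4 \<theta>) \<ge> 0\<close>. The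
  first one excludes that \<open>4 \<theta>\<close> exceeds \<open>\<pi>\<close>, and then the second one says \<open>4 \<theta> \<le> \<pi>/2\<close>.
\<close>
lemma Arg_le_pi_eighth_iff:
  assumes "z \<noteq> 0" "0 \<le> Re z" "0 \<le> Im z"
  shows "\<bar>Arg z\<bar> \<le> pi / 8 \<longleftrightarrow> 0 \<le> Re (z\<^sup>2) \<and> (norm (z\<^sup>2))\<^sup>2 \<le> 2 * (Re (z\<^sup>2))\<^sup>2"
proof -
  define \<theta> where "\<theta> = Arg z"
  define r where "r = norm z"
  have "0 < r"
    using assms(1) by (simp add: r_def)
  have \<theta>: "0 \<le> \<theta>" "\<theta> \<le> pi / 2"
    using assms Arg_Re_nonneg[of z] Arg_less_0[of z] unfolding \<theta>_def by fastforce+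
  have z: "z = of_real r * cis \<theta>"
    using Arg_eq[OF assms(1)] by (simp add: r_def \<theta>_def cis_conv_exp)
  have z2: "z\<^sup>2 = of_real (r\<^sup>2) * cis (2 * \<theta>)"
    by (simp add: z power_mult_distrib Complex.DeMoivre)
  have Re_z2: "Re (z\<^sup>2) = r\<^sup>2 * cos (2 * \<theta>)"
    by (simp add: z2 del: of_real_power)
  have norm_z2: "norm (z\<^sup>2) = r\<^sup>2"
    by (simp add: norm_power r_def)
  have "(norm (z\<^sup>2))\<^sup>2 \<le> 2 * (Re (z\<^sup>2))\<^sup>2
      \<longleftrightarrow> (r\<^sup>2)\<^sup>2 * 1 \<le> (r\<^sup>2)\<^sup>2 * (2 * (cos (2 * \<theta>))\<^sup>2)"
    unfolding Re_z2 norm_z2 by (simp only: power_mult_distrib mult_1_right) (simp only: mult_ac)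
  also have "\<dots> \<longleftrightarrow> 1 \<le> 2 * (cos (2 * \<theta>))\<^sup>2"
    using \<open>0 < r\<close> by (intro mult_le_cancel_left_pos) simp
  also have "\<dots> \<longleftrightarrow> 0 \<le> cos (4 * \<theta>)"
    using cos_double_cos[of "2 * \<theta>"] by simp
  finally have "0 \<le> Re (z\<^sup>2) \<and> (norm (z\<^sup>2))\<^sup>2 \<le> 2 * (Re (z\<^sup>2))\<^sup>2
      \<longleftrightarrow> 0 \<le> cos (2 * \<theta>) \<and> 0 \<le> cos (4 * \<theta>)"
    using \<open>0 < r\<close> by (simp add: Re_z2 zero_le_mult_iff)
  also have "\<dots> \<longleftrightarrow> \<theta> \<le> pi / 8"
  proof
    assume "\<theta> \<le> pi / 8"
    then show "0 \<le> cos (2 * \<theta>) \<and> 0 \<le> cos (4 * \<theta>)"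
      using \<theta> by (intro conjI cos_ge_zero) auto
  next
    assume nonneg: "0 \<le> cos (2 * \<theta>) \<and> 0 \<le> cos (4 * \<theta>)"
    have "2 * \<theta> \<le> pi / 2"
    proof (rule ccontr)
      assume "\<not> 2 * \<theta> \<le> pi / 2"
      then have "cos (2 * \<theta>) < cos (pi / 2)"
        using \<theta> by (intro cos_monotone_0_pi) auto
      then show False
        using nonneg by simp
    qed
    show "\<theta> \<le> pi / 8"
    proof (rule ccontr)
      assume "\<not> \<theta> \<le> pi / 8"
      then have "cos (4 * \<theta>) < cos (pi / 2)"
        using \<theta> \<open>2 * \<theta> \<le> pi / 2\<close> by (intro cos_monotone_0_pi) auto
      then show False
        using nonneg by simp
    qed
  qed
  finally show ?thesis
    using \<theta>(1) by (simp add: \<theta>_def)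
qed

lemma norm_square_one_minus_real_multiple:
  "(norm (1 - of_real s * u))\<^sup>2 = 1 - 2 * Re u * s + (norm u)\<^sup>2 * s\<^sup>2"
  unfolding cmod_power2 by (simp add: power2_eq_square algebra_simps)

section \<open>The zeros of the characteristic function decide strict subgaussianity\<close>

context symmetric_subgaussian
begin

text \<open>
  Both the moment generating function and the variance are read off from the factorisation of the
  characteristic function as a function of \<open>w\<^sup>2\<close>. The factor with \<open>\<gamma>\<close> contributes equally to both sides
  of the strict subgaussian inequality, and the multiplicity is a common exponent.
\<close>
lemma strictly_subgaussian_iff_reciprocal_square:
  assumes zeros: "\<And>w. complex_char M X w = 0 \<longleftrightarrow> w\<^sup>2 = \<zeta> \<or> w\<^sup>2 = cnj \<zeta>"
  defines "u \<equiv> 1 / \<zeta>"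
  shows "strictly_subgaussian M X \<longleftrightarrow> 0 \<le> Re u \<and> (norm u)\<^sup>2 \<le> 2 * (Re u)\<^sup>2"
proof -
  obtain K where K: "K holomorphic_on UNIV" "exponential_type K" "\<And>w. K (w\<^sup>2) = complex_char M X w"
    and K': "(K has_field_derivative - of_real (variance X) / 2) (at 0)"
    by (rule complex_char_as_function_of_square) blast
  have K0: "K 0 = 1"
    using K(3)[of 0] by (simp add: complex_char_def prob_space)
  have K_zeros: "K s = 0 \<longleftrightarrow> s = \<zeta> \<or> s = cnj \<zeta>" for s
    using zeros[of "csqrt s"] K(3)[of "csqrt s"] by simp
  have "\<zeta> \<noteq> 0"
    using K0 K_zeros[of 0] by auto
  obtain \<gamma> N where "0 < N"
    and norm_K: "\<And>s. norm (K (of_real s)) = exp (\<gamma> * s) * norm (1 - of_real s / \<zeta>) ^ N"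
    by (rule norm_on_reals_conjugate_zero_pair[OF K(1,2) K0 K_zeros]) blast
  define Q where "Q = (\<lambda>s. 1 - 2 * Re u * s + (norm u)\<^sup>2 * s\<^sup>2)"
  have norm_K_square: "(norm (K (of_real s)))\<^sup>2 = exp (2 * \<gamma> * s) * Q s ^ N" for s
  proof -
    have "(norm (K (of_real s)))\<^sup>2 = (exp (\<gamma> * s))\<^sup>2 * ((norm (1 - of_real s * u))\<^sup>2) ^ N"
      by (simp add: norm_K u_def power_mult_distrib flip: power_mult)
         (simp add: mult.commute)
    also have "(exp (\<gamma> * s))\<^sup>2 = exp (2 * \<gamma> * s)"
      by (simp add: power2_eq_square flip: exp_add)
    finally show ?thesis
      by (simp add: norm_square_one_minus_real_multiple Q_def)
  qed
  \<comment> \<open>The squared modulus is a real function on the line with derivative \<open>2 Re (K' 0)\<close> at 0.\<close>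
  have variance_eq: "variance X = 2 * N * Re u - 2 * \<gamma>"
  proof -
    have K_real: "((\<lambda>s. K (of_real s)) has_vector_derivative - of_real (variance X) / 2) (at 0)"
      using K' by (intro has_vector_derivative_real_field) simp
    have "((\<lambda>s. Re (K (of_real s))) has_real_derivative - variance X / 2) (at 0)"
      using bounded_linear.has_vector_derivative[OF bounded_linear_Re K_real]
      by (simp add: has_real_derivative_iff_has_vector_derivative)
    moreover have "((\<lambda>s. Im (K (of_real s))) has_real_derivative 0) (at 0)"
      using bounded_linear.has_vector_derivative[OF bounded_linear_Im K_real]
      by (simp add: has_real_derivative_iff_has_vector_derivative)
    ultimately have "((\<lambda>s. (norm (K (of_real s)))\<^sup>2) has_real_derivative - variance X) (at 0)"
      unfolding cmod_power2 using DERIV_add[OF DERIV_power[where n = 2] DERIV_power[where n = 2]]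
      by (fastforce simp: K0)
    moreover have "((\<lambda>s. (norm (K (of_real s)))\<^sup>2) has_real_derivative 2 * \<gamma> - 2 * N * Re u) (at 0)"
      unfolding norm_K_square Q_def by (auto intro!: derivative_eq_intros)
    ultimately show ?thesis
      using DERIV_unique by fastforce
  qed
  define L where "L = (\<lambda>t. expectation (\<lambda>\<omega>. exp (t * X \<omega>)))"
  have L_nonneg: "0 \<le> L t" for t
    by (simp add: L_def)
  have L_square: "(L t)\<^sup>2 = exp (- 2 * \<gamma> * t\<^sup>2) * Q (- t\<^sup>2) ^ N" for t
  proof -
    have "K (of_real (- t\<^sup>2)) = of_real (L t)"
      using K(3)[of "- \<i> * of_real t"] complex_char_imaginary[of t]
      by (simp add: L_def power_mult_distrib)
    then have "(L t)\<^sup>2 = (norm (K (of_real (- t\<^sup>2))))\<^sup>2"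
      by (metis norm_of_real power2_abs)
    then show ?thesis
      by (simp only: norm_K_square) simp
  qed
  have Q_nonneg: "0 \<le> Q s" for s
    unfolding Q_def by (metis norm_square_one_minus_real_multiple zero_le_power2)
  \<comment> \<open>Squaring makes the factorisation of the squared modulus applicable.\<close>
  have bound_iff: "L t \<le> exp (variance X * t\<^sup>2 / 2) \<longleftrightarrow> Q (- t\<^sup>2) \<le> exp (2 * Re u * t\<^sup>2)" for t
  proof -
    have "L t \<le> exp (variance X * t\<^sup>2 / 2) \<longleftrightarrow> (L t)\<^sup>2 \<le> (exp (variance X * t\<^sup>2 / 2))\<^sup>2"
      using L_nonneg by (simp add: power_mono_iff)
    also have "(exp (variance X * t\<^sup>2 / 2))\<^sup>2 = exp (- 2 * \<gamma> * t\<^sup>2) * exp (2 * Re u * t\<^sup>2) ^ N"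
    proof -
      have "variance X * t\<^sup>2 = - 2 * \<gamma> * t\<^sup>2 + N * (2 * Re u * t\<^sup>2)"
        unfolding variance_eq by (simp add: algebra_simps)
      then show ?thesis
        by (simp flip: exp_double exp_add exp_of_nat_mult)
    qed
    also have "(L t)\<^sup>2 \<le> \<dots> \<longleftrightarrow> Q (- t\<^sup>2) ^ N \<le> exp (2 * Re u * t\<^sup>2) ^ N"
      by (simp add: L_square)
    also have "\<dots> \<longleftrightarrow> Q (- t\<^sup>2) \<le> exp (2 * Re u * t\<^sup>2)"
      using Q_nonneg \<open>0 < N\<close> by (simp add: power_mono_iff)
    finally show ?thesis .
  qed
  have "strictly_subgaussian M X \<longleftrightarrow> (\<forall>t. L t \<le> exp (variance X * t\<^sup>2 / 2))"
    by (simp add: strictly_subgaussian_def L_def exp_integrable)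
  also have "\<dots> \<longleftrightarrow> (\<forall>s\<ge>0. Q (- s) \<le> exp (2 * Re u * s))"
    unfolding bound_iff by (metis real_sqrt_pow2 zero_le_power2)
  also have "\<dots> \<longleftrightarrow> 0 \<le> Re u \<and> (norm u)\<^sup>2 \<le> 2 * (Re u)\<^sup>2"
    using quadratic_le_exp_iff[of "(norm u)\<^sup>2" "Re u"] \<open>\<zeta> \<noteq> 0\<close> by (simp add: Q_def u_def)
  finally show ?thesis .
qed

lemma complex_char_cnj: "complex_char M X (cnj w) = cnj (complex_char M X w)"
  unfolding complex_char_eq_cos by (subst Bochner_Integration.integral_cnj[symmetric]) (simp add: cnj_cos)

text \<open>
  The characteristic function is even and commutes with conjugation, so its zeros are those in the
  quadrant and their reflections in the axes and the origin.
\<close>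
lemma complex_char_zeros_of_quadrant_zero:
  assumes quadrant: "{w. Re w \<ge> 0 \<and> Im w \<ge> 0 \<and> complex_char M X w = 0} = {z}"
  shows "complex_char M X w = 0 \<longleftrightarrow> w\<^sup>2 = z\<^sup>2 \<or> w\<^sup>2 = cnj (z\<^sup>2)"
proof -
  have minus: "complex_char M X (- v) = complex_char M X v" for v
    by (simp add: complex_char_eq_cos)
  define v where "v = Complex \<bar>Re w\<bar> \<bar>Im w\<bar>"
  have v: "v \<in> {w, - w, cnj w, - cnj w}"
    by (auto simp: v_def complex_eq_iff abs_if)
  then have "complex_char M X w = 0 \<longleftrightarrow> complex_char M X v = 0"
    by (auto simp: minus complex_char_cnj)
  also have "\<dots> \<longleftrightarrow> v = z"
  proof -
    have "v \<in> {w. Re w \<ge> 0 \<and> Im w \<ge> 0 \<and> complex_char M X w = 0} \<longleftrightarrow> complex_char M X v = 0"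
      by (simp add: v_def)
    then show ?thesis
      unfolding quadrant by simp
  qed
  also have "\<dots> \<longleftrightarrow> w\<^sup>2 = z\<^sup>2 \<or> w\<^sup>2 = cnj (z\<^sup>2)"
  proof
    assume "v = z"
    then show "w\<^sup>2 = z\<^sup>2 \<or> w\<^sup>2 = cnj (z\<^sup>2)"
      using v by auto
  next
    assume "w\<^sup>2 = z\<^sup>2 \<or> w\<^sup>2 = cnj (z\<^sup>2)"
    then have "w\<^sup>2 = z\<^sup>2 \<or> w\<^sup>2 = (cnj z)\<^sup>2"
      by simp
    then have "w \<in> {z, - z, cnj z, - cnj z}"
      unfolding power2_eq_iff by blast
    moreover have "0 \<le> Re z" "0 \<le> Im z"
      using quadrant by auto
    ultimately show "v = z"
      by (auto simp: v_def complex_eq_iff)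
  qed
  finally show ?thesis .
qed

end

theorem theorem1p4:
  fixes M :: "'a measure" and X :: "'a \<Rightarrow> real" and z :: complex
  assumes "prob_space M"
    and "X \<in> borel_measurable M"
    and "symmetric_distribution M X"
    and "subgaussian M X"
    and "{w. Re w \<ge> 0 \<and> Im w \<ge> 0 \<and> complex_char M X w = 0} = {z}"
  shows "strictly_subgaussian M X \<longleftrightarrow> \<bar>Arg z\<bar> \<le> pi / 8"
proof -
  interpret prob_space M
    by fact
  interpret symmetric_subgaussian M X
    using assms by unfold_locales
  have z: "0 \<le> Re z" "0 \<le> Im z" "complex_char M X z = 0"
    using assms(5) by auto
  have "z \<noteq> 0"
    using z(3) by (auto simp: complex_char_def prob_space)
  \<comment> \<open>The reciprocal of \<open>z\<^sup>2\<close> is \<open>c\<close> times its conjugate, so the condition on it is one on \<open>z\<^sup>2\<close>.\<close>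
  define c where "c = inverse ((norm (z\<^sup>2))\<^sup>2)"
  have "0 < c"
    using \<open>z \<noteq> 0\<close> by (simp add: c_def)
  have Re_u: "Re (1 / z\<^sup>2) = c * Re (z\<^sup>2)"
    by (simp add: c_def Re_divide' field_simps)
  have norm_u: "(norm (1 / z\<^sup>2))\<^sup>2 = c * c * (norm (z\<^sup>2))\<^sup>2"
    using \<open>z \<noteq> 0\<close> by (simp add: c_def norm_divide field_simps)
  have "strictly_subgaussian M X \<longleftrightarrow> 0 \<le> Re (1 / z\<^sup>2) \<and> (norm (1 / z\<^sup>2))\<^sup>2 \<le> 2 * (Re (1 / z\<^sup>2))\<^sup>2"
    by (rule strictly_subgaussian_iff_reciprocal_square[OF complex_char_zeros_of_quadrant_zero[OF assms(5)]])
  also have "\<dots> \<longleftrightarrow> 0 \<le> Re (z\<^sup>2) \<and> (norm (z\<^sup>2))\<^sup>2 \<le> 2 * (Re (z\<^sup>2))\<^sup>2"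
  proof -
    have "2 * (Re (1 / z\<^sup>2))\<^sup>2 = c * c * (2 * (Re (z\<^sup>2))\<^sup>2)"
      unfolding Re_u by (simp only: power2_eq_square mult_ac)
    then show ?thesis
      unfolding norm_u unfolding Re_u
      using \<open>0 < c\<close> by (simp add: zero_le_mult_iff mult_le_cancel_left_pos)
  qed
  also have "\<dots> \<longleftrightarrow> \<bar>Arg z\<bar> \<le> pi / 8"
    by (rule Arg_le_pi_eighth_iff[OF \<open>z \<noteq> 0\<close> z(1,2), symmetric])
  finally show ?thesis .
qed

end
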